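(* If $T$ is a (finite) tree, then $\mathrm{MOF}(T) = \alpha(T)$.
   Context: An orientation $D$ of a simple graph $G$ assigns to each edge exactly one direction; if $(u,v)$ is an arc, $v$ is an out-neighbor of $u$. Oriented $1$-forcing: starting from a nonempty set $S$ of colored vertices, repeatedly, any colored vertex with at most one non-colored out-neighbor forces that out-neighbor to become colored (all forcings in a step simultaneous), until no change occurs; $S$ is a forcing set if all vertices end up colored. $F(D)$ is the minimum size of a forcing set of $D$, and $\mathrm{MOF}(G)$ is the maximum of $F(D)$ over all orientations $D$ of $G$. $\alpha(T)$ is the independence number of $T$. *)

theory Defs
  imports "Graph_Theory.Graph_Theory"
begin

text \<open>
  A finite simple graph is a \<^locale>\<open>pair_graph\<close>: a finite loop-free symmetric digraph in
  which the edge between \<open>u\<close> and \<open>v\<close> is the pair of arcs \<open>(u, v)\<close> and \<open>(v, u)\<close>.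
\<close>

text \<open>
  The library predicate \<^const>\<open>tree\<close> is not usable for a symmetric digraph, since there an
  edge traversed back and forth is a \<open>pre_digraph.cycle\<close> of length 2. The cycles of a simple
  graph are exactly those of length at least 3. The library's \<^const>\<open>connected\<close> includes
  that the vertex set is nonempty.
\<close>

definition simple_tree :: "'a pair_pre_digraph \<Rightarrow> bool" where
  "simple_tree G \<longleftrightarrow> pair_graph G \<and> connected (with_proj G) \<and>
     \<not> (\<exists>p. pre_digraph.cycle (with_proj G) p \<and> 3 \<le> length p)"

definition independent_set :: "'a pair_pre_digraph \<Rightarrow> 'a set \<Rightarrow> bool" where
  "independent_set G I \<longleftrightarrow> I \<subseteq> pverts G \<and> (\<forall>u\<in>I. \<forall>v\<in>I. (u, v) \<notin> parcs G)"

definition independence_number :: "'a pair_pre_digraph \<Rightarrow> nat" where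
  "independence_number G = Max (card ` {I. independent_set G I})"

definition orientation :: "'a pair_pre_digraph \<Rightarrow> 'a pair_pre_digraph \<Rightarrow> bool" where
  "orientation G D \<longleftrightarrow> pverts D = pverts G \<and> parcs D \<subseteq> parcs G \<and>
     (\<forall>(u, v)\<in>parcs G. ((u, v) \<in> parcs D) \<noteq> ((v, u) \<in> parcs D))"

definition uncolored_out_neighbors :: "'a pair_pre_digraph \<Rightarrow> 'a set \<Rightarrow> 'a \<Rightarrow> 'a set" where
  "uncolored_out_neighbors D C u = {v. (u, v) \<in> parcs D \<and> v \<notin> C}"

definition forcing_step :: "'a pair_pre_digraph \<Rightarrow> 'a set \<Rightarrow> 'a set" where
  "forcing_step D C =
     C \<union> (\<Union>u\<in>{u \<in> C. card (uncolored_out_neighbors D C u) \<le> 1}. uncolored_out_neighbors D C u)"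

text \<open>
  In a finite digraph the increasing sequence of colored sets becomes stationary, and all
  vertices are finally colored iff they are all colored after some number of steps.
\<close>

definition forcing_set :: "'a pair_pre_digraph \<Rightarrow> 'a set \<Rightarrow> bool" where
  "forcing_set D S \<longleftrightarrow> S \<noteq> {} \<and> S \<subseteq> pverts D \<and> (\<exists>n. (forcing_step D ^^ n) S = pverts D)"

definition forcing_number :: "'a pair_pre_digraph \<Rightarrow> nat" where
  "forcing_number D = Min (card ` {S. forcing_set D S})"

definition MOF :: "'a pair_pre_digraph \<Rightarrow> nat" where
  "MOF G = Max (forcing_number ` {D. orientation G D})"

text \<open>
  The following facts ensure that the uses of \<^const>\<open>Max\<close> and \<^const>\<open>Min\<close> above are over
  finite nonempty sets.
\<close>

lemma finite_independent_sets: "pair_graph G \<Longrightarrow> finite {I. independent_set G I}"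
proof -
  assume "pair_graph G"
  then interpret pair_graph G .
  have "{I. independent_set G I} \<subseteq> Pow (pverts G)"
    by (simp add: independent_set_def subset_iff)
  then show ?thesis
    using pair_finite_verts finite_subset by blast
qed

lemma independent_sets_nonempty: "{I. independent_set G I} \<noteq> {}"
proof -
  have "independent_set G {}" by (simp add: independent_set_def)
  then show ?thesis by blast
qed

lemma finite_forcing_sets: "finite (pverts D) \<Longrightarrow> finite {S. forcing_set D S}"
  by (rule finite_subset[of _ "Pow (pverts D)"]) (auto simp: forcing_set_def)

lemma forcing_sets_nonempty: "pverts D \<noteq> {} \<Longrightarrow> {S. forcing_set D S} \<noteq> {}"
proof -
  assume "pverts D \<noteq> {}"
  moreover have "(forcing_step D ^^ 0) (pverts D) = pverts D" by simp
  ultimately have "forcing_set D (pverts D)" unfolding forcing_set_def by blast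
  then show ?thesis by blast
qed

lemma finite_orientations:
  assumes "pair_graph G"
  shows "finite {D. orientation G D}"
proof -
  interpret pair_graph G by fact
  have "{D. orientation G D} \<subseteq> (\<lambda>A. \<lparr>pverts = pverts G, parcs = A\<rparr>) ` Pow (parcs G)"
  proof
    fix D assume "D \<in> {D. orientation G D}"
    then show "D \<in> (\<lambda>A. \<lparr>pverts = pverts G, parcs = A\<rparr>) ` Pow (parcs G)"
      by (cases D) (auto simp: orientation_def)
  qed
  then show ?thesis
    by (rule finite_subset) (simp add: pair_finite_arcs)
qed

lemma orientations_nonempty:
  assumes "pair_graph G"
  shows "{D. orientation G D} \<noteq> {}"
proof -
  interpret pair_graph G by fact
  obtain f :: "'a \<Rightarrow> nat" where f: "inj_on f (pverts G)"
    using finite_imp_inj_to_nat_seg[OF pair_finite_verts] by blast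
  have sym: "(v, u) \<in> parcs G" if "(u, v) \<in> parcs G" for u v
    using pair_sym_arcs that unfolding symmetric_def with_proj_simps by (rule symD)
  have ne: "f u \<noteq> f v" if "(u, v) \<in> parcs G" for u v
    using inj_onD[OF f] pair_no_loops[OF that] in_arcsD1[OF that] in_arcsD2[OF that] by auto
  have "orientation G \<lparr>pverts = pverts G, parcs = {(u, v) \<in> parcs G. f u < f v}\<rparr>"
    unfolding orientation_def
  proof (intro conjI ballI case_prodI2)
    fix e u v assume "e \<in> parcs G" "e = (u, v)"
    then show "((u, v) \<in> parcs \<lparr>pverts = pverts G, parcs = {(u, v) \<in> parcs G. f u < f v}\<rparr>) \<noteq>
      ((v, u) \<in> parcs \<lparr>pverts = pverts G, parcs = {(u, v) \<in> parcs G. f u < f v}\<rparr>)"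
      using sym[of u v] ne[of u v] by (simp add: linorder_neq_iff) linarith
  qed auto
  then show ?thesis by blast
qed

end

theory Submission
  imports Defs
begin

text \<open>
  Lower bound: orient all edges meeting a maximum independent set away from it; its vertices are
  then sources, and every forcing set contains all sources.

  Upper bound: for an orientation of a forest, a forcing set and an independent set of at least
  the same size are built together by induction. Remove a leaf \<open>v\<close> with its neighbor \<open>p\<close>; then
  \<open>v\<close> joins the independent set, and the tail of the arc between \<open>v\<close> and \<open>p\<close> joins the forcing
  set. If \<open>v\<close> is the tail, it forces \<open>p\<close> at once; if \<open>p\<close> is the tail, it forces \<open>v\<close> at the end.
\<close>

section \<open>Leaves of forests\<close>

text \<open>Used to cut a longest path at a neighbor of its start, so that one more arc closes the
  prefix to a cycle.\<close>

lemma (in pair_wf_digraph) apath_prefix: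
  assumes "apath u p v" "y \<in> set (pawalk_verts u p)"
  shows "\<exists>q r. p = q @ r \<and> apath u q y"
  using assms
proof (induction p arbitrary: u)
  case Nil
  then show ?case by (auto simp: apath_Nil_iff)
next
  case (Cons e p)
  show ?case
  proof (cases "y = u")
    case True
    have "u \<in> pverts G" using Cons.prems(1) by (auto simp: apath_Cons_iff arc_fst_in_verts)
    with True have "apath u [] y" by (simp add: apath_Nil_iff)
    then show ?thesis by auto
  next
    case False
    with Cons.prems have p: "e \<in> parcs G" "fst e = u" "apath (snd e) p v"
      "u \<notin> set (pawalk_verts (snd e) p)" "y \<in> set (pawalk_verts (snd e) p)"
      by (auto simp: apath_Cons_iff)
    then obtain q r where q: "p = q @ r" "apath (snd e) q y" using Cons.IH by blast
    have "u \<notin> set (pawalk_verts (snd e) q)"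
      using Cons.prems(1) q(1) apath_append_iff[of u "e # q" r v] by (auto simp: apath_Cons_iff)
    with p q have "apath u (e # q) y" by (auto simp: apath_Cons_iff)
    with q(1) show ?thesis by (metis append_Cons)
  qed
qed

text \<open>A longest path inside \<open>W\<close> cannot be extended at its start \<open>u\<close>,
  so all neighbors of \<open>u\<close> in \<open>W\<close> lie on it, and one other than the second
  vertex would close a cycle of length at least 3. An arbitrary \<open>W\<close> spares the later
  induction from forming induced subgraphs; \<open>v\<close> may be isolated in
  \<open>W\<close>.\<close>

lemma (in pair_graph) forest_leaf:
  assumes acyclic: "\<And>p. cycle p \<Longrightarrow> length p < 3"
    and W: "W \<subseteq> pverts G" "W \<noteq> {}"
  shows "\<exists>v\<in>W. \<exists>p. \<forall>u\<in>W. (u, v) \<in> parcs G \<longrightarrow> u = p"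
proof (rule ccontr)
  assume "\<not> ?thesis"
  then have two: "\<exists>y\<in>W. (y, v) \<in> parcs G \<and> y \<noteq> x" if "v \<in> W" for v x
    using that by blast
  define P where "P n \<longleftrightarrow> (\<exists>u p v. apath u p v \<and> set (pawalk_verts u p) \<subseteq> W \<and> length p = n)" for n
  obtain w where "w \<in> W" using W by blast
  with W have "apath w [] w" by (auto simp: apath_Nil_iff)
  with \<open>w \<in> W\<close> have P0: "P 0" unfolding P_def by (intro exI[of _ w] exI[of _ "[]"]) auto
  have bound: "n \<le> card W" if "P n" for n
  proof -
    from that obtain u p v where p: "apath u p v" "set (pawalk_verts u p) \<subseteq> W" "length p = n"
      unfolding P_def by blast
    have "length (pawalk_verts u p) = Suc (length p)" by (induction p arbitrary: u) auto
    moreover have "card (set (pawalk_verts u p)) = length (pawalk_verts u p)"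
      using p(1) by (simp add: apath_def distinct_card)
    moreover have "card (set (pawalk_verts u p)) \<le> card W"
      using p(2) W pair_finite_verts by (meson card_mono finite_subset)
    ultimately show ?thesis using p(3) by simp
  qed
  define m where "m = (GREATEST n. P n)"
  have "P m" unfolding m_def using P0 bound by (rule GreatestI_nat)
  then obtain u p v where p: "apath u p v" "set (pawalk_verts u p) \<subseteq> W" "length p = m"
    unfolding P_def by blast
  have u: "u \<in> W" using p(1,2) by (cases p) (auto simp: apath_Cons_iff)
  \<comment> \<open>\<open>snd (hd p)\<close> is the second vertex of the path. For
    \<open>p = []\<close> it is an unspecified value, which is harmless: then \<open>y\<close> on
    the path means \<open>y = u\<close>, a loop.\<close>
  obtain y where y: "y \<in> W" "(y, u) \<in> parcs G" "y \<noteq> snd (hd p)" using two[OF u] by blast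
  have "y \<in> set (pawalk_verts u p)"
  proof (rule ccontr)
    assume "y \<notin> set (pawalk_verts u p)"
    with p y have "apath y ((y, u) # p) v" "set (pawalk_verts y ((y, u) # p)) \<subseteq> W"
      by (auto simp: apath_Cons_iff)
    with p(3) have "P (Suc m)" unfolding P_def by (metis length_Cons)
    then have "Suc m \<le> m" unfolding m_def using bound by (rule Greatest_le_nat)
    then show False by simp
  qed
  then obtain q r where q: "p = q @ r" "apath u q y" using apath_prefix p(1) by blast
  have "cycle ((y, u) # q)"
    unfolding cycle_def using q(2) y(2) by (intro exI[of _ y]) (auto simp: apath_def awalk_Cons_iff)
  then have "length q < 2" using acyclic by force
  \<comment> \<open>The two short cycles left are a loop at \<open>u\<close> and going back along
    the first arc of \<open>p\<close>; the choice of \<open>y\<close> excludes the latter.\<close>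
  then consider "q = []" | e where "q = [e]" by (auto simp: less_Suc_eq numeral_2_eq_2 length_Suc_conv)
  then show False
  proof cases
    case 1
    with q pair_no_loops[OF y(2)] show False by (auto simp: apath_Nil_iff)
  next
    case 2
    with q y(3) show False by (auto simp: apath_Cons_iff apath_Nil_iff)
  qed
qed

section \<open>Forcing\<close>

text \<open>
  Forcing in the sub-digraph of \<open>A\<close> induced by \<open>W\<close>, with the iteration replaced by closed sets
  so that the order of the forcings plays no role.
\<close>

definition forces :: "'a rel \<Rightarrow> 'a set \<Rightarrow> 'a set \<Rightarrow> bool" where
  "forces A W S \<longleftrightarrow> (\<forall>C. S \<subseteq> C \<and> C \<subseteq> W \<and>
     (\<forall>u\<in>C. \<forall>w\<in>W. (u, w) \<in> A \<and> (\<forall>x\<in>W. (u, x) \<in> A \<longrightarrow> x \<in> C \<or> x = w) \<longrightarrow> w \<in> C) \<longrightarrow> C = W)"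

text \<open>No vertex other than \<open>p\<close> has an arc to \<open>v\<close>, and
  \<open>p\<close> is in \<open>C\<close> from the start or forced by \<open>v\<close>. Hence the
  two removed vertices never block a forcing among the others, and \<open>C\<close> without them is
  closed in \<open>W - {v, p}\<close>. Once all of these are colored, only \<open>v\<close> can be
  left for \<open>p\<close> to force.\<close>

lemma forces_insert_tail:
  assumes forces: "forces A (W - {v, p}) S" and SW: "S \<subseteq> W - {v, p}"
    and W: "v \<in> W" "p \<in> W"
    and nbr: "\<And>u. u \<in> W \<Longrightarrow> (u, v) \<in> A \<or> (v, u) \<in> A \<Longrightarrow> u = p"
    and edge: "(p, v) \<in> A \<or> (v, p) \<in> A \<or> p = v"
  shows "forces A W (insert (if (p, v) \<in> A then p else v) S)"
  unfolding forces_def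
proof (intro allI impI, elim conjE)
  fix C
  assume S: "insert (if (p, v) \<in> A then p else v) S \<subseteq> C" and CW: "C \<subseteq> W"
    and closed: "\<forall>u\<in>C. \<forall>w\<in>W. (u, w) \<in> A \<and> (\<forall>x\<in>W. (u, x) \<in> A \<longrightarrow> x \<in> C \<or> x = w) \<longrightarrow> w \<in> C"
  have p: "p \<in> C"
  proof (cases "(p, v) \<in> A \<or> p = v")
    case True
    with S show ?thesis by (auto split: if_splits)
  next
    case False
    with S edge have "v \<in> C" "(v, p) \<in> A" by auto
    with closed W nbr show ?thesis by blast
  qed
  have "C - {v, p} = W - {v, p}"
  proof (rule forces[unfolded forces_def, rule_format], intro conjI ballI impI)
    show "S \<subseteq> C - {v, p}" using S SW by blast
    show "C - {v, p} \<subseteq> W - {v, p}" using CW by blast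
    fix u w assume u: "u \<in> C - {v, p}" and w: "w \<in> W - {v, p}"
      and uw: "(u, w) \<in> A \<and> (\<forall>x\<in>W - {v, p}. (u, x) \<in> A \<longrightarrow> x \<in> C - {v, p} \<or> x = w)"
    have "(u, v) \<notin> A" using nbr[of u] u CW by blast
    with uw p have "\<forall>x\<in>W. (u, x) \<in> A \<longrightarrow> x \<in> C \<or> x = w" by blast
    with closed u w uw show "w \<in> C - {v, p}" by blast
  qed
  then have rest: "W - {v} \<subseteq> C" using p by blast
  have "v \<in> C"
  proof (cases "(p, v) \<in> A")
    case True
    with closed p W(1) rest show ?thesis by blast
  next
    case False
    with S show ?thesis by simp
  qed
  with rest CW show "C = W" by blast
qed

text \<open>Induction on \<open>W\<close>. The old \<open>I\<close> avoids \<open>p\<close>, the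
  only possible neighbor of \<open>v\<close> in \<open>W\<close>, so \<open>v\<close> can be added;
  both sets gain exactly one new element.\<close>

lemma (in pair_graph) forest_forces:
  assumes acyclic: "\<And>p. cycle p \<Longrightarrow> length p < 3" and D: "orientation G D"
    and "W \<subseteq> pverts G"
  shows "\<exists>S I. S \<subseteq> W \<and> I \<subseteq> W \<and> independent_set G I \<and> card S \<le> card I \<and> forces (parcs D) W S"
  using finite_subset[OF \<open>W \<subseteq> pverts G\<close> pair_finite_verts] \<open>W \<subseteq> pverts G\<close>
proof (induction W rule: finite_psubset_induct)
  case (psubset W)
  show ?case
  proof (cases "W = {}")
    case True
    then show ?thesis by (auto simp: independent_set_def forces_def)
  next
    case False
    have sym: "(v, u) \<in> parcs G" if "(u, v) \<in> parcs G" for u v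
      using pair_sym_arcs that unfolding symmetric_def with_proj_simps by (rule symD)
    obtain v q where v: "v \<in> W" "\<forall>u\<in>W. (u, v) \<in> parcs G \<longrightarrow> u = q"
      using forest_leaf[OF acyclic psubset.prems False] by blast
    \<comment> \<open>If \<open>v\<close> is isolated in \<open>W\<close>, then
      \<open>p = v\<close>: only \<open>v\<close> is removed, and it joins both sets.\<close>
    define p where "p = (if q \<in> W \<and> (q, v) \<in> parcs G then q else v)"
    have p: "p \<in> W" and nbr: "\<And>u. u \<in> W \<Longrightarrow> (u, v) \<in> parcs G \<Longrightarrow> u = p"
      and edge: "(p, v) \<in> parcs G \<or> p = v"
      using v by (auto simp: p_def)
    have "W - {v, p} \<subset> W" "W - {v, p} \<subseteq> pverts G" using v psubset.prems by auto
    from psubset.IH[OF this] obtain S I where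
      SI: "S \<subseteq> W - {v, p}" "I \<subseteq> W - {v, p}" "independent_set G I" "card S \<le> card I" "forces (parcs D) (W - {v, p}) S"
      by blast
    let ?t = "if (p, v) \<in> parcs D then p else v"
    have DG: "parcs D \<subseteq> parcs G" using D by (simp add: orientation_def)
    have "forces (parcs D) W (insert ?t S)"
    proof (rule forces_insert_tail[OF SI(5,1) v(1) p])
      show "u = p" if "u \<in> W" "(u, v) \<in> parcs D \<or> (v, u) \<in> parcs D" for u
        using that nbr DG sym by blast
      show "(p, v) \<in> parcs D \<or> (v, p) \<in> parcs D \<or> p = v"
        using edge D by (fastforce simp: orientation_def)
    qed
    moreover have "independent_set G (insert v I)"
    proof -
      have "(v, v) \<notin> parcs G" using pair_no_loops by force
      moreover have "(u, v) \<notin> parcs G" if "u \<in> I" for u using nbr[of u] that SI(2) by blast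
      ultimately show ?thesis
        using SI(3) sym v(1) psubset.prems unfolding independent_set_def by blast
    qed
    moreover have "card (insert ?t S) \<le> card (insert v I)"
    proof -
      have "finite S" "finite I" using SI(1,2) psubset.hyps by (auto intro: finite_subset)
      moreover have "?t \<notin> S" "v \<notin> I" using SI(1,2) by auto
      ultimately show ?thesis using SI(4) by simp
    qed
    moreover have "insert ?t S \<subseteq> W" "insert v I \<subseteq> W" using SI(1,2) v(1) p by auto
    ultimately show ?thesis by blast
  qed
qed

section \<open>From closed sets back to iterated forcing steps\<close>

lemma forcing_step_subset:
  assumes "parcs D \<subseteq> pverts D \<times> pverts D" "C \<subseteq> pverts D"
  shows "forcing_step D C \<subseteq> pverts D"
  using assms unfolding forcing_step_def uncolored_out_neighbors_def by blast

text \<open>The iterates increase inside a finite set, so some iterate is a fixed point of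
  \<open>forcing_step\<close>; a fixed point is closed in the sense of
  \<open>forces\<close>.\<close>

lemma forces_imp_forcing_set:
  assumes fin: "finite (pverts D)" and ne: "pverts D \<noteq> {}"
    and wf: "parcs D \<subseteq> pverts D \<times> pverts D"
    and S: "S \<subseteq> pverts D" and forces: "forces (parcs D) (pverts D) S"
  shows "forcing_set D S"
proof -
  let ?C = "\<lambda>n. (forcing_step D ^^ n) S"
  have sub: "?C n \<subseteq> pverts D" for n
    by (induction n) (use S forcing_step_subset[OF wf] in auto)
  have step: "?C n \<subseteq> ?C (Suc n)" for n by (auto simp: forcing_step_def)
  have "\<exists>n. ?C (Suc n) = ?C n"
  proof (rule ccontr)
    assume "\<not> ?thesis"
    then have less: "card (?C n) < card (?C (Suc n))" for n
      using step sub fin by (metis finite_subset psubset_card_mono psubsetI)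
    have "n \<le> card (?C n)" for n
    proof (induction n)
      case (Suc n)
      with less[of n] show ?case by linarith
    qed simp
    moreover have "card (?C (Suc (card (pverts D)))) \<le> card (pverts D)"
      using sub fin by (rule card_mono[rotated])
    ultimately show False using Suc_n_not_le_n le_trans by blast
  qed
  then obtain n where n: "forcing_step D (?C n) = ?C n" by auto
  have "?C n = pverts D"
  proof (rule forces[unfolded forces_def, rule_format], intro conjI ballI impI)
    show "S \<subseteq> ?C n" using step lift_Suc_mono_le[of ?C 0 n] by auto
    show "?C n \<subseteq> pverts D" by (rule sub)
    fix u w assume u: "u \<in> ?C n" and w: "w \<in> pverts D"
      and uw: "(u, w) \<in> parcs D \<and> (\<forall>x\<in>pverts D. (u, x) \<in> parcs D \<longrightarrow> x \<in> ?C n \<or> x = w)"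
    then have "uncolored_out_neighbors D (?C n) u \<subseteq> {w}"
      using wf by (auto simp: uncolored_out_neighbors_def)
    then have "card (uncolored_out_neighbors D (?C n) u) \<le> 1"
      using card_mono[of "{w}"] by simp
    moreover have "w \<notin> ?C n \<Longrightarrow> w \<in> uncolored_out_neighbors D (?C n) u"
      using uw by (simp add: uncolored_out_neighbors_def)
    ultimately have "w \<in> forcing_step D (?C n)"
      using u unfolding forcing_step_def by blast
    then show "w \<in> ?C n" using n by simp
  qed
  moreover have "S \<noteq> {}"
  proof
    assume "S = {}"
    \<comment> \<open>The empty set is vacuously closed, so \<open>C = {}\<close> is admissible in
      \<open>forces\<close>.\<close>
    then have "{} = pverts D" using forces unfolding forces_def by blast
    with ne show False by simp
  qed
  ultimately show ?thesis using S unfolding forcing_set_def by blast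
qed

section \<open>Sources and the lower bound\<close>

lemma forcing_set_contains_source:
  assumes "forcing_set D S" "v \<in> pverts D" "\<And>u. (u, v) \<notin> parcs D"
  shows "v \<in> S"
proof -
  have "v \<in> (forcing_step D ^^ n) S \<Longrightarrow> v \<in> S" for n
    by (induction n) (use assms(3) in \<open>auto simp: forcing_step_def uncolored_out_neighbors_def\<close>)
  with assms(1,2) show ?thesis unfolding forcing_set_def by blast
qed

lemma independent_set_sources:
  assumes "pair_graph G" "independent_set G I"
  shows "\<exists>D. orientation G D \<and> (\<forall>v\<in>I. \<forall>u. (u, v) \<notin> parcs D)"
proof -
  obtain D where D: "orientation G D" using orientations_nonempty[OF assms(1)] by blast
  interpret pair_graph G by fact
  have sym: "(v, u) \<in> parcs G" if "(u, v) \<in> parcs G" for u v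
    using pair_sym_arcs that unfolding symmetric_def with_proj_simps by (rule symD)
  \<comment> \<open>\<open>D\<close> only decides the edges that avoid \<open>I\<close>. As no edge
    has both ends in \<open>I\<close>, exactly one direction of each edge survives.\<close>
  let ?A = "{(u, v) \<in> parcs G. v \<notin> I \<and> (u \<in> I \<or> (u, v) \<in> parcs D)}"
  have "orientation G \<lparr>pverts = pverts G, parcs = ?A\<rparr>"
    using D assms(2) sym unfolding orientation_def independent_set_def
    by (fastforce split: prod.splits)
  then show ?thesis by (intro exI conjI) auto
qed

theorem theorem3p23:
  fixes T :: "'a pair_pre_digraph"
  assumes "simple_tree T"
  shows "MOF T = independence_number T"
proof -
  from assms interpret pair_graph T by (simp add: simple_tree_def)
  have T: "pair_graph T" ..
  have acyclic: "length p < 3" if "cycle p" for p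
    using assms that by (auto simp: simple_tree_def not_le)
  have ne: "pverts T \<noteq> {}"
    using assms by (auto simp: simple_tree_def connected_def strongly_connected_def)
  have fin: "finite {S. forcing_set D S}" and exf: "{S. forcing_set D S} \<noteq> {}"
    if "orientation T D" for D
    using that ne pair_finite_verts finite_forcing_sets[of D] forcing_sets_nonempty[of D]
    by (simp_all add: orientation_def)
  have "forcing_number D \<le> independence_number T" if D: "orientation T D" for D
  proof -
    obtain S I where SI: "S \<subseteq> pverts T" "independent_set T I" "card S \<le> card I"
      "forces (parcs D) (pverts T) S"
      using forest_forces[OF acyclic D] by blast
    have "pverts D = pverts T" "parcs D \<subseteq> pverts T \<times> pverts T"
      using D arc_fst_in_verts arc_snd_in_verts by (force simp: orientation_def)+
    with SI ne pair_finite_verts have "forcing_set D S"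
      by (intro forces_imp_forcing_set) auto
    then have "forcing_number D \<le> card S"
      unfolding forcing_number_def using fin[OF D] by (intro Min_le) auto
    moreover have "card I \<le> independence_number T"
      unfolding independence_number_def using finite_independent_sets[OF T] SI(2)
      by (intro Max_ge) auto
    ultimately show ?thesis using SI(3) by linarith
  qed
  then have upper: "MOF T \<le> independence_number T"
    unfolding MOF_def using finite_orientations[OF T] orientations_nonempty[OF T]
    by (subst Max_le_iff) auto
  have "independence_number T \<in> card ` {I. independent_set T I}"
    unfolding independence_number_def
    using finite_independent_sets[OF T] independent_sets_nonempty by (intro Max_in) auto
  then obtain I where I: "independent_set T I" "card I = independence_number T" by auto
  obtain D where D: "orientation T D" "\<forall>v\<in>I. \<forall>u. (u, v) \<notin> parcs D"
    using independent_set_sources[OF T I(1)] by blast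
  have "card I \<le> card S" if S: "forcing_set D S" for S
  proof (rule card_mono)
    have "S \<subseteq> pverts T" using S D(1) by (simp add: forcing_set_def orientation_def)
    then show "finite S" using pair_finite_verts by (rule finite_subset)
    show "I \<subseteq> S"
      using forcing_set_contains_source[OF S] D I(1)
      by (auto simp: independent_set_def orientation_def)
  qed
  then have "card I \<le> forcing_number D"
    unfolding forcing_number_def using fin[OF D(1)] exf[OF D(1)] by (subst Min_ge_iff) auto
  also have "\<dots> \<le> MOF T"
    unfolding MOF_def using finite_orientations[OF T] D(1) by (intro Max_ge) auto
  finally show ?thesis using upper I(2) by simp
qed

end
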